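(* Let $(V,E)$ be a finite, undirected graph (multiple edges and loops allowed) which is regular of degree $d$. Assume there exist permutations $\theta_1,\ldots,\theta_d : V\to V$ such that for every $v\in V$ and $1\le i\le d$ the vertices $v$ and $\theta_i(v)$ are adjacent, and $\mathcal{N}(v)=\bigcup_{i=1}^d\{\theta_i(v)\}$ for every $v\in V$. Let $\mathcal{G}$ be a subgroup of the automorphism group of $(V,E)$ such that (1) no index two subgroup of $\mathcal{G}$ acts transitively on $V$, and (2) $\mathcal{G}$ acts transitively on $V$. Assume that $|V|\ge 4$, that $(V,E)$ is non-bipartite, and that $(V,E)$ is an $\varepsilon$-vertex expander for some $\varepsilon>0$. Then every nontrivial eigenvalue of the normalised adjacency operator of $(V,E)$ is greater than $$-1 + \frac{\varepsilon^4}{2^9 d^{10}}.$$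
   Context: For $V'\subseteq V$, $\mathcal{N}(V')$ denotes the set of vertices adjacent to some vertex of $V'$ (and $\mathcal{N}(v)=\mathcal{N}(\{v\})$). The graph is an $\varepsilon$-vertex expander if $|\mathcal{N}(A)\setminus A|\ge \varepsilon |A|$ for every $A\subseteq V$ with $|A|\le |V|/2$. Regular of degree $d$ means the adjacency matrix $A$ is symmetric with the constant vector as eigenvector of eigenvalue $d$; the normalised adjacency operator is $\frac1d A$, its trivial eigenvalue is $1$ (constant eigenvector), and the nontrivial eigenvalues are the remaining ones. *)

theory Defs
  imports "HOL-Analysis.Analysis" "HOL-Library.Uprod" "HOL-Library.Multiset"
    "HOL-Algebra.Coset" "HOL-Algebra.Group_Action"
begin

text \<open>
  The vertex set of a finite graph is the universe of a finite type \<open>'v\<close>; the edges form a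
  multiset of unordered pairs, so parallel edges and loops (\<open>Upair v v\<close>) are allowed.
\<close>

type_synonym 'v multigraph = "'v uprod multiset"

definition adjacent :: "'v multigraph \<Rightarrow> 'v \<Rightarrow> 'v \<Rightarrow> bool" where
  "adjacent E u v \<longleftrightarrow> Upair u v \<in># E"

definition nbhd :: "'v multigraph \<Rightarrow> 'v set \<Rightarrow> 'v set" where
  "nbhd E W = {v. \<exists>w\<in>W. adjacent E w v}"

text \<open>
  A loop contributes \<open>1\<close> to its diagonal entry. The convention in which it contributes \<open>2\<close> is the
  special case in which every loop is taken with even multiplicity.
\<close>

definition adjacency_matrix :: "'v::finite multigraph \<Rightarrow> real^'v^'v" where
  "adjacency_matrix E = (\<chi> u v. real (count E (Upair u v)))"

definition regular_of_degree :: "'v::finite multigraph \<Rightarrow> nat \<Rightarrow> bool" where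
  "regular_of_degree E d \<longleftrightarrow>
     transpose (adjacency_matrix E) = adjacency_matrix E \<and>
     adjacency_matrix E *v vec 1 = real d *s vec 1"

definition normalised_adjacency :: "'v::finite multigraph \<Rightarrow> nat \<Rightarrow> real^'v^'v" where
  "normalised_adjacency E d = (1 / real d) *\<^sub>R adjacency_matrix E"

definition matrix_eigenvalue :: "real^'n^'n \<Rightarrow> real \<Rightarrow> bool" where
  "matrix_eigenvalue M \<mu> \<longleftrightarrow> (\<exists>x. x \<noteq> 0 \<and> M *v x = \<mu> *s x)"

text \<open>
  Eigenvalues are counted with multiplicity and one copy of the eigenvalue \<open>1\<close>, belonging to the
  constant vectors, is discarded: \<open>1\<close> is still nontrivial if its eigenspace has dimension at
  least \<open>2\<close>. The operator is symmetric, so all its eigenvalues are real and their algebraic and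
  geometric multiplicities agree.
\<close>

definition nontrivial_eigenvalue :: "'v::finite multigraph \<Rightarrow> nat \<Rightarrow> real \<Rightarrow> bool" where
  "nontrivial_eigenvalue E d \<mu> \<longleftrightarrow>
     matrix_eigenvalue (normalised_adjacency E d) \<mu> \<and>
     (\<mu> = 1 \<longrightarrow> 2 \<le> dim {x. normalised_adjacency E d *v x = x})"

definition bipartite_graph :: "'v multigraph \<Rightarrow> bool" where
  "bipartite_graph E \<longleftrightarrow> (\<exists>X. \<forall>u v. adjacent E u v \<longrightarrow> (u \<in> X \<longleftrightarrow> v \<notin> X))"

definition vertex_expander :: "'v::finite multigraph \<Rightarrow> real \<Rightarrow> bool" where
  "vertex_expander E \<epsilon> \<longleftrightarrow>
     (\<forall>A. real (card A) \<le> real CARD('v) / 2 \<longrightarrow> real (card (nbhd E A - A)) \<ge> \<epsilon> * real (card A))"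

definition automorphism_group :: "'v multigraph \<Rightarrow> ('v \<Rightarrow> 'v) monoid" where
  "automorphism_group E =
     (BijGroup UNIV)\<lparr>carrier := {\<sigma> \<in> Bij UNIV. image_mset (map_uprod \<sigma>) E = E}\<rparr>"

definition acts_transitively :: "'v multigraph \<Rightarrow> ('v \<Rightarrow> 'v) set \<Rightarrow> bool" where
  "acts_transitively E H \<longleftrightarrow>
     transitive_action ((automorphism_group E)\<lparr>carrier := H\<rparr>) UNIV (\<lambda>\<sigma>. \<sigma>)"

definition index_two_subgroup :: "('a, 'b) monoid_scheme \<Rightarrow> 'a set \<Rightarrow> bool" where
  "index_two_subgroup G H \<longleftrightarrow> subgroup H G \<and> card (rcosets\<^bsub>G\<^esub> H) = 2"

lemma subgroup_automorphism_group:
  "subgroup {\<sigma> \<in> Bij UNIV. image_mset (map_uprod \<sigma>) E = E} (BijGroup (UNIV :: 'v set))"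
proof -
  let ?A = "{\<sigma> \<in> Bij (UNIV :: 'v set). image_mset (map_uprod \<sigma>) E = E}"
  interpret B: group "BijGroup (UNIV :: 'v set)" by (rule group_BijGroup)
  have id: "map_uprod (\<lambda>x. x) = (\<lambda>e :: 'v uprod. e)"
    by (rule ext, case_tac e) simp
  have comp: "map_uprod (\<lambda>x. f (g x)) = map_uprod f \<circ> map_uprod g" for f g :: "'v \<Rightarrow> 'v"
    by (rule ext, case_tac x) simp
  show ?thesis
  proof (rule B.subgroupI)
    show "?A \<subseteq> carrier (BijGroup UNIV)" by (auto simp: BijGroup_def)
    have "(\<lambda>x. x) \<in> ?A" by (auto simp: id Bij_def extensional_def bij_def surj_def inj_on_def)
    then show "?A \<noteq> {}" by blast
  next
    fix f assume f: "f \<in> ?A"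
    have i: "inv\<^bsub>BijGroup UNIV\<^esub> f = inv_into UNIV f"
      using f by (simp add: inv_BijGroup restrict_def)
    have iB: "inv_into UNIV f \<in> Bij UNIV"
      using f restrict_inv_into_Bij[of f UNIV] by (simp add: restrict_def)
    have "(\<lambda>x. inv_into UNIV f (f x)) = (\<lambda>x. x)"
      using f by (auto simp: Bij_def bij_betw_def)
    then have "image_mset (map_uprod (inv_into UNIV f)) (image_mset (map_uprod f) E) = E"
      using comp[of "inv_into UNIV f" f, symmetric] by (simp add: id multiset.map_comp)
    then show "inv\<^bsub>BijGroup UNIV\<^esub> f \<in> ?A" using f iB i by simp
  next
    fix f g assume f: "f \<in> ?A" and g: "g \<in> ?A"
    have m: "f \<otimes>\<^bsub>BijGroup UNIV\<^esub> g = (\<lambda>x. f (g x))"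
      using f g by (auto simp: BijGroup_def compose_def restrict_def)
    have "(\<lambda>x. f (g x)) \<in> Bij UNIV"
      using f g compose_Bij[of f UNIV g] by (simp add: compose_def restrict_def)
    moreover have "image_mset (map_uprod (\<lambda>x. f (g x))) E = E"
      using f g by (simp add: comp flip: multiset.map_comp)
    ultimately show "f \<otimes>\<^bsub>BijGroup UNIV\<^esub> g \<in> ?A" by (simp add: m)
  qed
qed

lemma group_automorphism_group: "group (automorphism_group E)"
  unfolding automorphism_group_def
  by (rule group.subgroup_imp_group[OF group_BijGroup subgroup_automorphism_group])

lemma acts_transitively_iff:
  fixes E :: "'v multigraph"
  assumes H: "subgroup H (automorphism_group E)"
  shows "acts_transitively E H \<longleftrightarrow> (\<forall>x y. \<exists>\<sigma>\<in>H. \<sigma> x = y)"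
proof -
  have "group ((automorphism_group E)\<lparr>carrier := H\<rparr>)"
    by (rule group.subgroup_imp_group[OF group_automorphism_group H])
  moreover have "H \<subseteq> Bij UNIV"
    using subgroup.subset[OF H] by (auto simp: automorphism_group_def)
  ultimately have "group_action ((automorphism_group E)\<lparr>carrier := H\<rparr>) UNIV (\<lambda>\<sigma>. \<sigma>)"
    using group_BijGroup[of "UNIV :: 'v set"]
    unfolding group_action_def group_hom_def group_hom_axioms_def
    by (auto simp: hom_def automorphism_group_def BijGroup_def)
  then show ?thesis
    by (simp add: acts_transitively_def transitive_action_def transitive_action_axioms_def)
qed

end

theory Submission
  imports Defs
begin

text \<open>
  Let \<open>f\<close> be an eigenvector with eigenvalue close to \<open>-1\<close>. Then \<open>\<bar>f\<bar>\<close> has small Dirichlet energy, so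
  by Cheeger's inequality it is close to a constant, and hence the sign of \<open>f\<close> changes along all but
  a few edges. For a symmetry \<open>g\<close> the set where \<open>f\<close> and \<open>f \<circ> g\<close> have equal signs then has a small
  edge boundary, so by expansion it is almost empty or almost everything. This yields a subgroup of
  index at most two on whose orbits the sign of \<open>f\<close> is nearly constant. As the graph is not
  bipartite, every vertex has a neighbour in its own orbit, so the sign of \<open>f\<close> fails to change
  along many edges, a contradiction.
\<close>

section \<open>Regular multigraphs as symmetric weights\<close>

locale regular_multigraph =
  fixes c :: "'v::finite \<Rightarrow> 'v \<Rightarrow> nat" and d :: nat
  assumes sym: "c x y = c y x"
    and row: "(\<Sum>y\<in>UNIV. c x y) = d"
begin

lemma row_real: "(\<Sum>y\<in>UNIV. real (c x y)) = real d"
  using row[of x] by (metis of_nat_sum)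

lemma sum_fst: "(\<Sum>x\<in>UNIV. \<Sum>y\<in>UNIV. real (c x y) * f x) = real d * (\<Sum>x\<in>UNIV. f x)"
  by (simp add: row_real sum_distrib_left flip: sum_distrib_right)

lemma sum_snd: "(\<Sum>x\<in>UNIV. \<Sum>y\<in>UNIV. real (c x y) * f y) = real d * (\<Sum>x\<in>UNIV. f x)"
  by (subst sum.swap, subst sum_fst[symmetric]) (simp add: sym)

text \<open>The sum runs over ordered pairs, so by symmetry of \<open>c\<close> every boundary edge
  is met once in each direction; hence the factor 2.\<close>

lemma boundary_indicator:
  "(\<Sum>x\<in>UNIV. \<Sum>y\<in>UNIV. real (c x y) * \<bar>of_bool (x \<in> A) - of_bool (y \<in> A)\<bar>)
     = 2 * (\<Sum>x\<in>A. \<Sum>y\<in>-A. real (c x y))"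
proof -
  have 1: "(\<Sum>x\<in>UNIV. \<Sum>y\<in>UNIV. real (c x y) * of_bool (x \<in> A \<and> y \<notin> A))
      = (\<Sum>x\<in>A. \<Sum>y\<in>-A. real (c x y))"
  proof -
    have "(\<Sum>x\<in>A. \<Sum>y\<in>-A. real (c x y))
        = (\<Sum>x\<in>UNIV. if x \<in> A then (\<Sum>y\<in>-A. real (c x y)) else 0)"
      by (simp add: sum.If_cases)
    also have "\<dots> = (\<Sum>x\<in>UNIV. \<Sum>y\<in>UNIV. real (c x y) * of_bool (x \<in> A \<and> y \<notin> A))"
    proof (rule sum.cong[OF refl])
      fix x
      show "(if x \<in> A then (\<Sum>y\<in>-A. real (c x y)) else 0)
          = (\<Sum>y\<in>UNIV. real (c x y) * of_bool (x \<in> A \<and> y \<notin> A))"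
        by (auto simp: of_bool_def if_distrib[of "\<lambda>z. _ * z"] sum.If_cases Compl_eq
            intro!: sum.cong)
    qed
    finally show ?thesis by simp
  qed
  have 2: "(\<Sum>x\<in>UNIV. \<Sum>y\<in>UNIV. real (c x y) * of_bool (y \<in> A \<and> x \<notin> A))
      = (\<Sum>x\<in>UNIV. \<Sum>y\<in>UNIV. real (c x y) * of_bool (x \<in> A \<and> y \<notin> A))"
    by (subst sum.swap) (simp add: sym)
  have 3: "real (c x y) * \<bar>of_bool (x \<in> A) - of_bool (y \<in> A)\<bar>
     = real (c x y) * of_bool (x \<in> A \<and> y \<notin> A) + real (c x y) * of_bool (y \<in> A \<and> x \<notin> A)" for x y
    by auto
  show ?thesis unfolding 3 sum.distrib 2 1 by simp
qed

text \<open>The left side is twice the quadratic form of d + A, with A the adjacency matrix. An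
  eigenvalue near -1 thus makes \<open>f x + f y\<close> small on average along edges.\<close>

lemma signless_energy_eigenvector:
  fixes f :: "'v \<Rightarrow> real"
  assumes "\<And>x. (\<Sum>y\<in>UNIV. real (c x y) * f y) = real d * \<mu> * f x"
  shows "(\<Sum>x\<in>UNIV. \<Sum>y\<in>UNIV. real (c x y) * (f x + f y)\<^sup>2)
    = 2 * real d * (1 + \<mu>) * (\<Sum>x\<in>UNIV. (f x)\<^sup>2)"
proof -
  have "real (c x y) * (f x + f y)\<^sup>2 = real (c x y) * (f x)\<^sup>2 + real (c x y) * (f y)\<^sup>2
      + (2 * f x) * (real (c x y) * f y)" for x y
    by (simp add: power2_sum algebra_simps)
  moreover have "(\<Sum>x\<in>UNIV. \<Sum>y\<in>UNIV. (2 * f x) * (real (c x y) * f y))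
      = 2 * real d * \<mu> * (\<Sum>x\<in>UNIV. (f x)\<^sup>2)"
    unfolding sum_distrib_left[symmetric] assms
    by (simp add: sum_distrib_left power2_eq_square mult_ac)
  ultimately show ?thesis
    by (simp add: sum.distrib sum_fst sum_snd algebra_simps)
qed

end

section \<open>Edge expansion and Cheeger's inequality\<close>

text \<open>Expansion is recorded for edge boundaries, the quantity that both the Cheeger and the
  symmetry arguments estimate. Vertex expansion implies it, as each outer neighbour of
  \<open>A\<close> receives at least one edge from \<open>A\<close>.\<close>

locale edge_expander = regular_multigraph c d
  for c :: "'v::finite \<Rightarrow> 'v \<Rightarrow> nat" and d :: nat +
  fixes \<epsilon> :: real
  assumes pos: "\<epsilon> > 0"
    and expand: "2 * card A \<le> CARD('v) \<Longrightarrow>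
      \<epsilon> * real (card A) \<le> (\<Sum>x\<in>A. \<Sum>y\<in>-A. real (c x y))"
begin

text \<open>Induction on the size of the support, peeling off its lowest level.\<close>

lemma coarea:
  fixes \<phi> :: "'v \<Rightarrow> real"
  assumes "\<And>x. \<phi> x \<ge> 0" and "2 * card {x. \<phi> x > 0} \<le> CARD('v)"
  shows "2 * \<epsilon> * (\<Sum>x\<in>UNIV. \<phi> x) \<le> (\<Sum>x\<in>UNIV. \<Sum>y\<in>UNIV. real (c x y) * \<bar>\<phi> x - \<phi> y\<bar>)"
  using assms
proof (induction "card {x. \<phi> x > 0}" arbitrary: \<phi> rule: less_induct)
  case less
  define S where "S = {x. \<phi> x > 0}"
  show ?case
  proof (cases "S = {}")
    case True
    then have "\<phi> x = 0" for x
      using less.prems(1)[of x] by (auto simp: S_def not_less intro: antisym)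
    then show ?thesis by simp
  next
    case False
    define a where "a = Min (\<phi> ` S)"
    have "a \<in> \<phi> ` S" unfolding a_def using False by (intro Min_in) auto
    then obtain z where z: "z \<in> S" "\<phi> z = a" by blast
    have apos: "a > 0" using z by (auto simp: S_def)
    have amin: "a \<le> \<phi> x" if "x \<in> S" for x unfolding a_def using that by (intro Min_le) auto
    have nS: "\<phi> x = 0" if "x \<notin> S" for x
      using less.prems(1)[of x] that by (auto simp: S_def)
    \<comment> \<open>Subtracting the least positive value keeps the function nonnegative and kills
      \<open>z\<close>, so the support shrinks strictly.\<close>
    define \<psi> where "\<psi> x = \<phi> x - a * of_bool (x \<in> S)" for x
    have \<psi>0: "\<psi> x \<ge> 0" for x using amin[of x] less.prems(1)[of x] by (auto simp: \<psi>_def)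
    have sub: "{x. \<psi> x > 0} \<subset> S"
    proof
      show "{x. \<psi> x > 0} \<subseteq> S" by (rule subsetI, rule ccontr) (simp add: \<psi>_def nS)
      show "{x. \<psi> x > 0} \<noteq> S" using z by (auto simp: \<psi>_def)
    qed
    then have lt: "card {x. \<psi> x > 0} < card S" by (intro psubset_card_mono) auto
    have IH: "2 * \<epsilon> * (\<Sum>x\<in>UNIV. \<psi> x) \<le> (\<Sum>x\<in>UNIV. \<Sum>y\<in>UNIV. real (c x y) * \<bar>\<psi> x - \<psi> y\<bar>)"
      using less.hyps[of \<psi>] lt \<psi>0 less.prems(2) by (auto simp: S_def)
    \<comment> \<open>Nothing cancels: on a pair leaving \<open>S\<close>, \<open>\<psi>\<close> is
      nonnegative at the inner vertex and zero at the outer one, so both differences have the same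
      sign.\<close>
    have split: "\<bar>\<phi> x - \<phi> y\<bar> = \<bar>\<psi> x - \<psi> y\<bar> + a * \<bar>of_bool (x \<in> S) - of_bool (y \<in> S)\<bar>" for x y
      using amin[of x] amin[of y] nS[of x] nS[of y] apos by (auto simp: \<psi>_def)
    have "(\<Sum>x\<in>UNIV. \<phi> x) = (\<Sum>x\<in>UNIV. \<psi> x) + a * real (card S)"
      by (simp add: \<psi>_def sum_subtractf flip: sum_distrib_left)
    moreover have "(\<Sum>x\<in>UNIV. \<Sum>y\<in>UNIV. real (c x y) * \<bar>\<phi> x - \<phi> y\<bar>)
       = (\<Sum>x\<in>UNIV. \<Sum>y\<in>UNIV. real (c x y) * \<bar>\<psi> x - \<psi> y\<bar>)
         + a * (2 * (\<Sum>x\<in>S. \<Sum>y\<in>-S. real (c x y)))"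
      unfolding split boundary_indicator[symmetric]
      by (simp add: distrib_left sum.distrib sum_distrib_left mult.left_commute)
    moreover have "a * (2 * (\<epsilon> * real (card S))) \<le> a * (2 * (\<Sum>x\<in>S. \<Sum>y\<in>-S. real (c x y)))"
      using expand[of S] less.prems(2) apos by (simp add: S_def)
    ultimately show ?thesis using IH by (simp add: algebra_simps)
  qed
qed

text \<open>AM-GM at weight \<open>2 d / \<epsilon>\<close> in place of Cauchy-Schwarz.\<close>

lemma cheeger_small_support:
  fixes h :: "'v \<Rightarrow> real"
  assumes h: "\<And>x. h x \<ge> 0" and supp: "2 * card {x. h x > 0} \<le> CARD('v)" and d: "d > 0"
  shows "\<epsilon>\<^sup>2 * (\<Sum>x\<in>UNIV. (h x)\<^sup>2) \<le> real d * (\<Sum>x\<in>UNIV. \<Sum>y\<in>UNIV. real (c x y) * (h x - h y)\<^sup>2)"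
proof -
  define t where "t = 2 * real d / \<epsilon>"
  have t: "t > 0" using d pos by (simp add: t_def)
  let ?S = "\<Sum>x\<in>UNIV. (h x)\<^sup>2"
  let ?D = "\<Sum>x\<in>UNIV. \<Sum>y\<in>UNIV. real (c x y) * (h x - h y)\<^sup>2"
  \<comment> \<open>\<open>coarea\<close> is applied to the square of \<open>h\<close>, which has
    the same support as \<open>h\<close>.\<close>
  have "{x. (h x)\<^sup>2 > 0} = {x. h x > 0}" using h by (auto simp: order.strict_iff_order)
  then have "2 * \<epsilon> * ?S \<le> (\<Sum>x\<in>UNIV. \<Sum>y\<in>UNIV. real (c x y) * \<bar>(h x)\<^sup>2 - (h y)\<^sup>2\<bar>)"
    using supp by (intro coarea) auto
  also have "\<dots> \<le> (\<Sum>x\<in>UNIV. \<Sum>y\<in>UNIV. real (c x y) *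
      (t / 2 * (h x - h y)\<^sup>2 + (1 / t) * (h x)\<^sup>2 + (1 / t) * (h y)\<^sup>2))"
  proof (intro sum_mono mult_left_mono)
    fix x y
    have "0 \<le> (t * \<bar>h x - h y\<bar> - (h x + h y))\<^sup>2" by simp
    then have "2 * t * (\<bar>h x - h y\<bar> * (h x + h y)) \<le> t\<^sup>2 * (h x - h y)\<^sup>2 + (h x + h y)\<^sup>2"
      by (simp add: power2_diff power_mult_distrib algebra_simps)
    also have "\<dots> \<le> t\<^sup>2 * (h x - h y)\<^sup>2 + 2 * (h x)\<^sup>2 + 2 * (h y)\<^sup>2"
      using zero_le_power2[of "h x - h y"] by (simp add: power2_diff power2_sum)
    finally have 1: "2 * t * (\<bar>h x - h y\<bar> * (h x + h y))
        \<le> t\<^sup>2 * (h x - h y)\<^sup>2 + 2 * (h x)\<^sup>2 + 2 * (h y)\<^sup>2" .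
    have "\<bar>(h x)\<^sup>2 - (h y)\<^sup>2\<bar> = \<bar>h x - h y\<bar> * (h x + h y)"
      using h[of x] h[of y]
      by (metis abs_mult abs_of_nonneg add_nonneg_nonneg mult.commute power2_eq_square
          square_diff_square_factored)
    then show "\<bar>(h x)\<^sup>2 - (h y)\<^sup>2\<bar> \<le> t / 2 * (h x - h y)\<^sup>2 + (1 / t) * (h x)\<^sup>2 + (1 / t) * (h y)\<^sup>2"
      using 1 t by (simp add: field_simps power2_eq_square)
  qed simp
  also have "\<dots> = t / 2 * ?D + 2 * real d / t * ?S"
  proof -
    have "(\<Sum>x\<in>UNIV. \<Sum>y\<in>UNIV. real (c x y) *
        (t / 2 * (h x - h y)\<^sup>2 + (1 / t) * (h x)\<^sup>2 + (1 / t) * (h y)\<^sup>2))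
      = t / 2 * ?D + (\<Sum>x\<in>UNIV. \<Sum>y\<in>UNIV. real (c x y) * ((1 / t) * (h x)\<^sup>2))
        + (\<Sum>x\<in>UNIV. \<Sum>y\<in>UNIV. real (c x y) * ((1 / t) * (h y)\<^sup>2))"
      unfolding distrib_left sum.distrib sum_distrib_left by (simp add: mult.left_commute)
    then show ?thesis
      unfolding sum_fst[of "\<lambda>x. (1 / t) * (h x)\<^sup>2"] sum_snd[of "\<lambda>x. (1 / t) * (h x)\<^sup>2"]
      by (simp add: sum_divide_distrib[symmetric])
  qed
  \<comment> \<open>The choice of \<open>t\<close> makes the last term exactly half of the left side
    \<open>2 * \<epsilon> * ?S\<close>, so it can be absorbed.\<close>
  also have "\<dots> = real d / \<epsilon> * ?D + \<epsilon> * ?S"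
    using pos d by (simp add: t_def)
  finally have "\<epsilon> * ?S \<le> real d / \<epsilon> * ?D" by simp
  then show ?thesis using pos by (simp add: field_simps power2_eq_square)
qed

end

section \<open>Medians and a Poincare inequality\<close>

lemma exists_median:
  fixes g :: "'v::finite \<Rightarrow> real"
  obtains z where "2 * card {x. g x > g z} \<le> CARD('v)" "2 * card {x. g x < g z} \<le> CARD('v)"
proof -
  \<comment> \<open>The median is taken as the least value of \<open>g\<close> with at most half of
    the vertices strictly above it.\<close>
  define M where "M = {a \<in> range g. 2 * card {x. g x > a} \<le> CARD('v)}"
  have "{x. g x > Max (range g)} = {}" by (auto simp: not_less)
  moreover have "Max (range g) \<in> range g" by (intro Max_in) auto
  ultimately have "Max (range g) \<in> M" unfolding M_def mem_Collect_eq
    by (simp only: card.empty) simp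
  then have "M \<noteq> {}" by blast
  moreover have fin: "finite M" by (simp add: M_def)
  ultimately have "Min M \<in> M" by (rule Min_in[rotated])
  then obtain z where z: "g z = Min M" "2 * card {x. g x > g z} \<le> CARD('v)"
    unfolding M_def by force
  have "2 * card {x. g x < g z} \<le> CARD('v)"
  proof (cases "{x. g x < g z} = {}")
    case False
    \<comment> \<open>\<open>b\<close> is the next value below the median. By minimality more than
      half of the vertices lie above \<open>b\<close>, and none of these lies below the
      median.\<close>
    define b where "b = Max (g ` {x. g x < g z})"
    have "b \<in> g ` {x. g x < g z}" unfolding b_def using False by (intro Max_in) auto
    then have b: "b \<in> range g" "b < g z" by auto
    have "b \<notin> M" using b(2) z(1) fin Min_le by fastforce
    then have c: "2 * card {x. g x > b} > CARD('v)" using b by (auto simp: M_def)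
    have "g x \<le> b" if "g x < g z" for x
      unfolding b_def using that by (intro Max_ge) auto
    then have "{x. g x < g z} \<subseteq> - {x. g x > b}" using leD by blast
    then have "card {x. g x < g z} \<le> card (- {x. g x > b})" by (intro card_mono) auto
    also have "\<dots> = CARD('v) - card {x. g x > b}" by (simp only: Compl_eq_Diff_UNIV card_Diff_subset[OF finite subset_UNIV])
    finally show ?thesis using c by linarith
  qed (simp add: card_eq_0_iff)
  with z that show thesis by blast
qed

context edge_expander
begin

text \<open>The positive and negative parts of \<open>g - g z\<close> each live on at most half of
  the vertices when \<open>g z\<close> is a median, so the Cheeger bound applies to both parts
  separately.\<close>

lemma poincare_median:
  fixes g :: "'v \<Rightarrow> real"
  assumes d: "d > 0"
  obtains z where "\<epsilon>\<^sup>2 * (\<Sum>x\<in>UNIV. (g x - g z)\<^sup>2)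
     \<le> real d * (\<Sum>x\<in>UNIV. \<Sum>y\<in>UNIV. real (c x y) * (g x - g y)\<^sup>2)"
proof -
  obtain z where z: "2 * card {x. g x > g z} \<le> CARD('v)" "2 * card {x. g x < g z} \<le> CARD('v)"
    by (rule exists_median)
  define p where "p x = max 0 (g x - g z)" for x
  define q where "q x = max 0 (g z - g x)" for x
  have "{x. p x > 0} = {x. g x > g z}" "{x. q x > 0} = {x. g x < g z}"
    by (auto simp: p_def q_def)
  then have *: "\<epsilon>\<^sup>2 * (\<Sum>x\<in>UNIV. (p x)\<^sup>2) \<le> real d * (\<Sum>x\<in>UNIV. \<Sum>y\<in>UNIV. real (c x y) * (p x - p y)\<^sup>2)"
    "\<epsilon>\<^sup>2 * (\<Sum>x\<in>UNIV. (q x)\<^sup>2) \<le> real d * (\<Sum>x\<in>UNIV. \<Sum>y\<in>UNIV. real (c x y) * (q x - q y)\<^sup>2)"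
    using z d by (intro cheeger_small_support; simp add: p_def q_def)+
  have sq: "(g x - g z)\<^sup>2 = (p x)\<^sup>2 + (q x)\<^sup>2" for x
    by (auto simp: p_def q_def max_def power2_commute)
  have diff: "(p x - p y)\<^sup>2 + (q x - q y)\<^sup>2 \<le> (g x - g y)\<^sup>2" for x y
  proof -
    \<comment> \<open>The parts have disjoint supports, so the two sides of the inequality below
      differ by \<open>2 * (p x * q y + p y * q x)\<close>, which is nonnegative.\<close>
    have "0 \<le> p x * q y" "0 \<le> p y * q x" "p x * q x = 0" "p y * q y = 0"
      by (auto simp: p_def q_def max_def)
    then have "(p x - p y)\<^sup>2 + (q x - q y)\<^sup>2 \<le> ((p x - q x) - (p y - q y))\<^sup>2"
      by (auto simp add: power2_eq_square algebra_simps)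
    moreover have "(p x - q x) - (p y - q y) = g x - g y" by (auto simp: p_def q_def)
    ultimately show ?thesis by simp
  qed
  have "(\<Sum>x\<in>UNIV. \<Sum>y\<in>UNIV. real (c x y) * (p x - p y)\<^sup>2)
      + (\<Sum>x\<in>UNIV. \<Sum>y\<in>UNIV. real (c x y) * (q x - q y)\<^sup>2)
     \<le> (\<Sum>x\<in>UNIV. \<Sum>y\<in>UNIV. real (c x y) * (g x - g y)\<^sup>2)"
    unfolding sum.distrib[symmetric] distrib_left[symmetric]
    by (intro sum_mono mult_left_mono diff) simp
  from mult_left_mono[OF this, of "real d"] *
  have "\<epsilon>\<^sup>2 * (\<Sum>x\<in>UNIV. (g x - g z)\<^sup>2)
     \<le> real d * (\<Sum>x\<in>UNIV. \<Sum>y\<in>UNIV. real (c x y) * (g x - g y)\<^sup>2)"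
    unfolding sq sum.distrib distrib_left by simp
  then show thesis by (rule that)
qed

section \<open>From an eigenvalue near -1 to a near-bipartition\<close>

lemma expansion_le_degree:
  assumes "CARD('v) \<ge> 2"
  shows "\<epsilon> \<le> real d"
proof -
  fix x :: 'v
  have "\<epsilon> \<le> (\<Sum>y\<in>-{x}. real (c x y))" using expand[of "{x}"] assms by simp
  also have "\<dots> \<le> (\<Sum>y\<in>UNIV. real (c x y))" by (rule sum_mono2) auto
  finally show ?thesis by (simp add: row_real)
qed

text \<open>\<open>P\<close> is the set where \<open>f\<close> is nonnegative. By the Poincare
  inequality the absolute value of \<open>f\<close> is close to its median \<open>m\<close> in mean
  square. An edge whose ends have equal sign then has \<open>f x + f y\<close> of size about
  \<open>2 * m\<close>, and the small signless energy leaves room for few such edges.\<close>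

lemma nearly_bipartite:
  fixes f :: "'v \<Rightarrow> real"
  assumes eig: "\<And>x. (\<Sum>y\<in>UNIV. real (c x y) * f y) = real d * \<mu> * f x"
    and nz: "\<exists>x. f x \<noteq> 0"
    and n: "CARD('v) \<ge> 2"
    and \<mu>: "1 + \<mu> \<le> \<epsilon> ^ 4 / (2 ^ 9 * real d ^ 5)"
  obtains P where "(\<Sum>x\<in>UNIV. \<Sum>y\<in>UNIV. real (c x y) * of_bool ((x \<in> P) = (y \<in> P)))
      \<le> real CARD('v) * (\<epsilon>\<^sup>2 / (16 * (real d)\<^sup>2))"
proof -
  have ed: "\<epsilon> \<le> real d" by (rule expansion_le_degree[OF n])
  with pos have d: "d > 0" "real d \<ge> 1" by (auto intro: Suc_leI)
  let ?n = "real CARD('v)"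
  define N where "N = (\<Sum>x\<in>UNIV. (f x)\<^sup>2)"
  define B where "B = (\<Sum>x\<in>UNIV. \<Sum>y\<in>UNIV. real (c x y) * of_bool ((f x \<ge> 0) = (f y \<ge> 0)))"
  define g where "g x = \<bar>f x\<bar>" for x
  \<comment> \<open>\<open>\<delta>\<close> bounds \<open>1 + \<mu>\<close>. The Poincare inequality
    turns it into the relative variance bound
    \<open>\<tau> = 2 * d^2 * \<delta> / \<epsilon>^2\<close>.\<close>
  define \<delta> where "\<delta> = \<epsilon> ^ 4 / (2 ^ 9 * real d ^ 5)"
  define \<tau> where "\<tau> = \<epsilon>\<^sup>2 / (256 * real d ^ 3)"
  have Npos: "N > 0"
    unfolding N_def using nz by (metis UNIV_I finite sum_pos2 zero_le_power2 zero_less_power2)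
  have Q: "(\<Sum>x\<in>UNIV. \<Sum>y\<in>UNIV. real (c x y) * (f x + f y)\<^sup>2) \<le> 2 * real d * \<delta> * N"
    unfolding signless_energy_eigenvector[OF eig] N_def[symmetric]
    using \<mu> Npos by (intro mult_right_mono mult_left_mono) (auto simp: \<delta>_def)
  have E: "(\<Sum>x\<in>UNIV. \<Sum>y\<in>UNIV. real (c x y) * (g x - g y)\<^sup>2)
      \<le> (\<Sum>x\<in>UNIV. \<Sum>y\<in>UNIV. real (c x y) * (f x + f y)\<^sup>2)"
  proof (intro sum_mono mult_left_mono)
    fix x y
    have "\<bar>g x - g y\<bar> \<le> \<bar>f x + f y\<bar>" by (simp add: g_def)
    then show "(g x - g y)\<^sup>2 \<le> (f x + f y)\<^sup>2" by (simp add: abs_le_square_iff)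
  qed simp
  obtain z where z: "\<epsilon>\<^sup>2 * (\<Sum>x\<in>UNIV. (g x - g z)\<^sup>2)
     \<le> real d * (\<Sum>x\<in>UNIV. \<Sum>y\<in>UNIV. real (c x y) * (g x - g y)\<^sup>2)"
    using poincare_median[OF d(1)] by blast
  define m where "m = g z"
  define V where "V = (\<Sum>x\<in>UNIV. (g x - m)\<^sup>2)"
  have "\<epsilon>\<^sup>2 * V \<le> real d * (2 * real d * \<delta> * N)"
    unfolding V_def m_def using z order.trans[OF E Q] d(2)
    by (meson mult_left_mono order.trans of_nat_0_le_iff)
  also have "\<dots> = \<epsilon>\<^sup>2 * (\<tau> * N)"
    using d pos by (simp add: \<delta>_def \<tau>_def field_simps power2_eq_square numeral_eq_Suc)
  finally have V: "V \<le> \<tau> * N" using pos by simp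
  have e2: "\<epsilon>\<^sup>2 \<le> (real d)\<^sup>2" using ed pos by (intro power_mono) auto
  have \<tau>: "\<tau> \<le> 1 / 256"
  proof -
    have "\<epsilon>\<^sup>2 \<le> real d ^ 3" using e2 power_increasing[of 2 3 "real d"] d(2) by linarith
    then show ?thesis using d by (simp add: \<tau>_def field_simps)
  qed
  have \<delta>: "\<delta> \<le> \<tau> / 2"
  proof -
    have "\<delta> = \<tau> / 2 * (\<epsilon>\<^sup>2 / (real d)\<^sup>2)"
      using d by (simp add: \<delta>_def \<tau>_def field_simps power2_eq_square numeral_eq_Suc)
    also have "\<dots> \<le> \<tau> / 2 * 1"
      using e2 d by (intro mult_left_mono) (auto simp: \<tau>_def)
    finally show ?thesis by simp
  qed
  \<comment> \<open>The small variance forces the median to carry a fixed share of the norm; this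
    lower bound for the square of \<open>m\<close> is what allows dividing by it.\<close>
  have "N \<le> (\<Sum>x\<in>UNIV. 2 * m\<^sup>2 + 2 * (g x - m)\<^sup>2)"
    unfolding N_def
  proof (rule sum_mono)
    fix x
    have "0 \<le> (g x - 2 * m)\<^sup>2" by simp
    moreover have "(f x)\<^sup>2 = (g x)\<^sup>2" by (simp add: g_def)
    ultimately show "(f x)\<^sup>2 \<le> 2 * m\<^sup>2 + 2 * (g x - m)\<^sup>2"
      by (simp add: power2_diff algebra_simps)
  qed
  also have "\<dots> = 2 * ?n * m\<^sup>2 + 2 * V" by (simp add: sum.distrib V_def sum_distrib_left)
  finally have "N \<le> 2 * ?n * m\<^sup>2 + 2 * (\<tau> * N)" using V by linarith
  moreover have "\<tau> * N \<le> 1 / 256 * N" using \<tau> Npos by (intro mult_right_mono) auto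
  ultimately have nm: "127 / 256 * N \<le> ?n * m\<^sup>2" by linarith
  have "4 * m\<^sup>2 * B = (\<Sum>x\<in>UNIV. \<Sum>y\<in>UNIV. real (c x y) *
      (4 * m\<^sup>2 * of_bool ((f x \<ge> 0) = (f y \<ge> 0))))"
    unfolding B_def sum_distrib_left by (simp only: mult.left_commute)
  also have "\<dots> \<le> (\<Sum>x\<in>UNIV. \<Sum>y\<in>UNIV. real (c x y) *
      (2 * (f x + f y)\<^sup>2 + 4 * (g x - m)\<^sup>2 + 4 * (g y - m)\<^sup>2))"
  proof (intro sum_mono mult_left_mono)
    fix x y
    show "4 * m\<^sup>2 * of_bool ((f x \<ge> 0) = (f y \<ge> 0))
       \<le> 2 * (f x + f y)\<^sup>2 + 4 * (g x - m)\<^sup>2 + 4 * (g y - m)\<^sup>2"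
    proof (cases "(f x \<ge> 0) = (f y \<ge> 0)")
      case True
      then have fg: "(f x + f y)\<^sup>2 = (g x + g y)\<^sup>2"
        by (auto simp: g_def power2_eq_square algebra_simps)
      \<comment> \<open>Write \<open>2 * m\<close> as
        \<open>(g x + g y) - ((g x - m) + (g y - m))\<close> and use that the square of a sum or
        difference is at most twice the sum of the squares, two times.\<close>
      have "0 \<le> ((g x + g y) + (g x - m) + (g y - m))\<^sup>2" "0 \<le> ((g x - m) - (g y - m))\<^sup>2" by simp_all
      then have "4 * m\<^sup>2 \<le> 2 * (g x + g y)\<^sup>2 + 4 * (g x - m)\<^sup>2 + 4 * (g y - m)\<^sup>2"
        by (simp add: power2_eq_square algebra_simps)
      with True fg show ?thesis by simp
    qed simp
  qed simp
  also have "\<dots> = 2 * (\<Sum>x\<in>UNIV. \<Sum>y\<in>UNIV. real (c x y) * (f x + f y)\<^sup>2) + 8 * real d * V"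
  proof -
    have "(\<Sum>x\<in>UNIV. \<Sum>y\<in>UNIV. real (c x y) *
        (2 * (f x + f y)\<^sup>2 + 4 * (g x - m)\<^sup>2 + 4 * (g y - m)\<^sup>2))
      = 2 * (\<Sum>x\<in>UNIV. \<Sum>y\<in>UNIV. real (c x y) * (f x + f y)\<^sup>2)
        + (\<Sum>x\<in>UNIV. \<Sum>y\<in>UNIV. real (c x y) * (4 * (g x - m)\<^sup>2))
        + (\<Sum>x\<in>UNIV. \<Sum>y\<in>UNIV. real (c x y) * (4 * (g y - m)\<^sup>2))"
      unfolding distrib_left sum.distrib sum_distrib_left by (simp add: mult.left_commute)
    then show ?thesis
      unfolding sum_fst[of "\<lambda>x. 4 * (g x - m)\<^sup>2"] sum_snd[of "\<lambda>x. 4 * (g x - m)\<^sup>2"]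
      by (simp add: V_def sum_distrib_left[symmetric])
  qed
  also have "\<dots> \<le> 10 * real d * (\<tau> * N)"
  proof -
    have "2 * (2 * real d * \<delta> * N) \<le> 2 * real d * (\<tau> * N)"
      using \<delta> Npos d by (simp add: mult.assoc)
    moreover have "8 * real d * V \<le> 8 * real d * (\<tau> * N)" using V by (intro mult_left_mono) auto
    ultimately show ?thesis using Q by (simp add: algebra_simps)
  qed
  finally have mB: "4 * m\<^sup>2 * B \<le> 10 * real d * (\<tau> * N)" .
  have B0: "B \<ge> 0" unfolding B_def by (intro sum_nonneg) auto
  have "4 * (127 / 256 * N) * B \<le> 4 * (?n * m\<^sup>2) * B"
    using nm B0 by (intro mult_right_mono mult_left_mono) auto
  also have "\<dots> \<le> ?n * (10 * real d * (\<tau> * N))"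
    using mult_left_mono[OF mB, of ?n] by (simp add: mult_ac)
  finally have "N * (127 / 64 * B) \<le> N * (10 * ?n * real d * \<tau>)" by (simp add: mult_ac)
  then have "127 / 64 * B \<le> 10 * ?n * real d * \<tau>" using Npos by simp
  also have "\<dots> = 10 / 256 * (?n * (\<epsilon>\<^sup>2 / (real d)\<^sup>2))"
    using d by (simp add: \<tau>_def field_simps power2_eq_square numeral_eq_Suc)
  finally have B1: "127 / 64 * B \<le> 10 / 256 * (?n * (\<epsilon>\<^sup>2 / (real d)\<^sup>2))" .
  \<comment> \<open>The constant obtained is about 0.02, below 1/16.\<close>
  have "0 \<le> ?n * (\<epsilon>\<^sup>2 / (real d)\<^sup>2)" by simp
  with B1 have "B \<le> 1 / 16 * (?n * (\<epsilon>\<^sup>2 / (real d)\<^sup>2))" by linarith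
  then show thesis using that[of "{x. f x \<ge> 0}"] by (simp add: B_def mult_ac)
qed

section \<open>Symmetries acting on a near-bipartition\<close>

text \<open>Along an edge leaving the agreement set, exactly one of the 2-colourings given by
  \<open>P\<close> and by its preimage under \<open>g\<close> is unchanged. Both have the same
  number of unchanged edges, as \<open>g\<close> is an automorphism, so the boundary is small and
  expansion applies to the smaller of the set and its complement.\<close>

lemma agreement_dichotomy:
  fixes P :: "'v set" and g :: "'v \<Rightarrow> 'v"
  assumes B: "(\<Sum>x\<in>UNIV. \<Sum>y\<in>UNIV. real (c x y) * of_bool ((x \<in> P) = (y \<in> P))) \<le> b"
    and g: "bij g" "\<And>x y. c (g x) (g y) = c x y"
  shows "\<epsilon> * real (card {x. (x \<in> P) = (g x \<in> P)}) \<le> b \<or>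
         \<epsilon> * real (card {x. (x \<in> P) \<noteq> (g x \<in> P)}) \<le> b"
proof -
  define A where "A = {x. (x \<in> P) = (g x \<in> P)}"
  have nA: "{x. (x \<in> P) \<noteq> (g x \<in> P)} = -A" by (auto simp: A_def)
  have "(\<Sum>x\<in>UNIV. \<Sum>y\<in>UNIV. real (c x y) * of_bool ((g x \<in> P) = (g y \<in> P)))
      = (\<Sum>x\<in>UNIV. \<Sum>y\<in>UNIV. real (c x y) * of_bool ((x \<in> P) = (y \<in> P)))"
  proof -
    have "(\<Sum>x\<in>UNIV. \<Sum>y\<in>UNIV. real (c (g x) (g y)) * of_bool ((g x \<in> P) = (g y \<in> P)))
      = (\<Sum>x\<in>UNIV. \<Sum>y\<in>UNIV. real (c (g x) y) * of_bool ((g x \<in> P) = (y \<in> P)))"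
      by (intro sum.cong refl sum.reindex_bij_betw[OF g(1)])
    also have "\<dots> = (\<Sum>x\<in>UNIV. \<Sum>y\<in>UNIV. real (c x y) * of_bool ((x \<in> P) = (y \<in> P)))"
      by (rule sum.reindex_bij_betw[OF g(1)])
    finally show ?thesis by (simp only: g(2))
  qed
  then have B': "(\<Sum>x\<in>UNIV. \<Sum>y\<in>UNIV. real (c x y) * of_bool ((g x \<in> P) = (g y \<in> P))) \<le> b"
    using B by simp
  have bd: "(\<Sum>x\<in>S. \<Sum>y\<in>-S. real (c x y)) \<le> b" if S: "S = A \<or> S = -A" for S
  proof -
    have "2 * (\<Sum>x\<in>S. \<Sum>y\<in>-S. real (c x y)) \<le>
       (\<Sum>x\<in>UNIV. \<Sum>y\<in>UNIV. real (c x y) * of_bool ((x \<in> P) = (y \<in> P))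
         + real (c x y) * of_bool ((g x \<in> P) = (g y \<in> P)))"
      unfolding boundary_indicator[symmetric]
      using S by (intro sum_mono) (auto simp: A_def)
    also have "\<dots> \<le> 2 * b" using B B' by (simp only: sum.distrib)
    finally show ?thesis by simp
  qed
  have "card A + card (-A) = CARD('v)"
    by (metis Compl_partition Compl_disjoint card_Un_disjoint finite)
  then consider "2 * card A \<le> CARD('v)" | "2 * card (-A) \<le> CARD('v)" by linarith
  then show ?thesis
  proof cases
    case 1
    then show ?thesis using expand[OF 1] bd[of A] unfolding A_def[symmetric] by auto
  next
    case 2
    then show ?thesis using expand[OF 2] bd[of "-A"] unfolding nA by auto
  qed
qed

text \<open>If few edges were unchanged, the symmetries almost preserving \<open>P\<close> would
  form a subgroup \<open>H\<close> of index at most two, and membership in \<open>P\<close> would be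
  nearly constant on its orbits. Non-bipartiteness puts edges inside these orbits at every vertex,
  and most of them would be unchanged.\<close>

lemma many_unchanged_edges:
  fixes P :: "'v set" and G :: "('v \<Rightarrow> 'v) set"
  assumes n: "CARD('v) \<ge> 2"
    and id: "(\<lambda>x. x) \<in> G"
    and comp: "\<And>g h. g \<in> G \<Longrightarrow> h \<in> G \<Longrightarrow> (\<lambda>x. g (h x)) \<in> G"
    and inv: "\<And>g. g \<in> G \<Longrightarrow> inv_into UNIV g \<in> G"
    and bij: "\<And>g. g \<in> G \<Longrightarrow> bij g"
    and aut: "\<And>g x y. g \<in> G \<Longrightarrow> c (g x) (g y) = c x y"
    and trans: "\<And>x y. \<exists>g\<in>G. g x = y"
    and nonbip: "\<And>X. \<exists>u v. c u v > 0 \<and> (u \<in> X) = (v \<in> X)"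
  shows "(\<Sum>x\<in>UNIV. \<Sum>y\<in>UNIV. real (c x y) * of_bool ((x \<in> P) = (y \<in> P)))
      > real CARD('v) * (\<epsilon>\<^sup>2 / (16 * (real d)\<^sup>2))"
proof (rule ccontr)
  let ?n = "real CARD('v)"
  define B where "B = (\<Sum>x\<in>UNIV. \<Sum>y\<in>UNIV. real (c x y) * of_bool ((x \<in> P) = (y \<in> P)))"
  assume "\<not> ?thesis"
  then have B: "B \<le> ?n * (\<epsilon>\<^sup>2 / (16 * (real d)\<^sup>2))" by (simp add: B_def)
  have ed: "\<epsilon> \<le> real d" by (rule expansion_le_degree[OF n])
  with pos have d: "d > 0" "real d \<ge> 1" by (auto intro: Suc_leI)
  have n0: "?n > 0" by simp
  have ed1: "\<epsilon> / real d \<le> 1" "0 \<le> \<epsilon> / real d" using ed d pos by auto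
  have "(\<epsilon> / real d)\<^sup>2 \<le> 1" using power_mono[OF ed1, of 2] by simp
  then have "?n / 16 * (\<epsilon> / real d)\<^sup>2 \<le> ?n / 16 * 1" by (intro mult_left_mono) auto
  moreover have "?n * (\<epsilon>\<^sup>2 / (16 * (real d)\<^sup>2)) = ?n / 16 * (\<epsilon> / real d)\<^sup>2"
    by (simp add: power_divide)
  ultimately have B1: "B \<le> ?n / 16" using B by linarith
  \<comment> \<open>Small enough that \<open>2 * d * \<eta> = 1/8\<close> in the final
    count.\<close>
  define \<eta> where "\<eta> = 1 / (16 * real d)"
  have \<eta>: "\<eta> > 0" "\<eta> \<le> 1 / 16" using d by (auto simp: \<eta>_def field_simps)
  define dis where "dis g = card {x. (x \<in> P) \<noteq> (g x \<in> P)}" for g :: "'v \<Rightarrow> 'v"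
  define agr where "agr g = card {x. (x \<in> P) = (g x \<in> P)}" for g :: "'v \<Rightarrow> 'v"
  have total: "agr g + dis g = CARD('v)" for g
  proof -
    have "{x. (x \<in> P) = (g x \<in> P)} \<union> {x. (x \<in> P) \<noteq> (g x \<in> P)} = UNIV" by auto
    moreover have "agr g + dis g = card ({x. (x \<in> P) = (g x \<in> P)} \<union> {x. (x \<in> P) \<noteq> (g x \<in> P)})"
      unfolding agr_def dis_def by (rule card_Un_disjoint[symmetric]) auto
    ultimately show ?thesis by (simp only:)
  qed
  have small: "real k \<le> \<eta> * ?n" if "\<epsilon> * real k \<le> ?n * (\<epsilon>\<^sup>2 / (16 * (real d)\<^sup>2))" for k
  proof -
    have "?n * (\<epsilon>\<^sup>2 / (16 * (real d)\<^sup>2)) = \<epsilon> * (\<eta> * ?n * (\<epsilon> / real d))"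
      using d by (simp add: \<eta>_def field_simps power2_eq_square)
    with that have "\<epsilon> * real k \<le> \<epsilon> * (\<eta> * ?n * (\<epsilon> / real d))" by (simp only:)
    then have "real k \<le> \<eta> * ?n * (\<epsilon> / real d)" using pos by (simp only: mult_le_cancel_left_pos)
    also have "\<dots> \<le> \<eta> * ?n * 1" using ed1 \<eta> by (intro mult_left_mono) auto
    finally show ?thesis by simp
  qed
  have dich: "real (agr g) \<le> \<eta> * ?n \<or> real (dis g) \<le> \<eta> * ?n" if "g \<in> G" for g
    using agreement_dichotomy[OF B[unfolded B_def] bij[OF that] aut[OF that]] small
    unfolding agr_def dis_def by blast
  have \<eta>n: "\<eta> * ?n \<le> ?n / 16" using \<eta> mult_right_mono[of \<eta> "1/16" ?n] by simp
  \<comment> \<open>the symmetries \<open>g\<close> with \<open>s \<circ> g \<approx> s\<close>, where \<open>s\<close> is the sign function of \<open>P\<close>; all others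
    satisfy \<open>s \<circ> g \<approx> - s\<close>\<close>
  define H where "H = {g \<in> G. real (dis g) \<le> \<eta> * ?n}"
  have notH: "real (agr g) \<le> \<eta> * ?n" if "g \<in> G" "g \<notin> H" for g
    using dich[of g] that by (auto simp: H_def)
  \<comment> \<open>The dichotomy leaves a gap: disagreement is at most \<open>\<eta> * ?n\<close>
    or close to \<open>?n\<close>. Hence a doubled error falls back to the original bound, and
    errors do not accumulate under composition.\<close>
  have big: "g \<in> H" if "g \<in> G" "real (dis g) \<le> 2 * (\<eta> * ?n)" for g
  proof (rule ccontr)
    assume "g \<notin> H"
    then have "real (agr g) \<le> \<eta> * ?n" using notH that by blast
    moreover have "real (agr g) + real (dis g) = ?n" using total[of g] by linarith
    ultimately show False using that \<eta>n n0 by linarith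
  qed
  have pre: "card {x. Q (h x)} = card {x. Q x}" if "h \<in> G" for h and Q :: "'v \<Rightarrow> bool"
    using card_vimage_inj[of h "{x. Q x}"] bij[OF that]
    by (simp add: bij_is_inj bij_is_surj vimage_def)
  have tri: "card {x. Q1 x} \<le> card {x. Q2 x} + card {x. Q3 x}"
    if "\<And>x. Q1 x \<Longrightarrow> Q2 x \<or> Q3 x" for Q1 Q2 Q3 :: "'v \<Rightarrow> bool"
  proof -
    have "card {x. Q1 x} \<le> card ({x. Q2 x} \<union> {x. Q3 x})" using that by (intro card_mono) auto
    also have "\<dots> \<le> card {x. Q2 x} + card {x. Q3 x}" by (rule card_Un_le)
    finally show ?thesis .
  qed
  have HG: "g \<in> G" if "g \<in> H" for g using that by (simp add: H_def)
  have Hid: "(\<lambda>x. x) \<in> H" using id \<eta> n0 by (simp add: H_def dis_def)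
  \<comment> \<open>Two approximate sign flips compose to an approximate identity; this gives
    closure of \<open>H\<close> and index at most two at once.\<close>
  have same: "(\<lambda>x. g (h x)) \<in> H" if g: "g \<in> G" and h: "h \<in> G" and gh: "(g \<in> H) = (h \<in> H)" for g h
  proof (rule big)
    show "(\<lambda>x. g (h x)) \<in> G" using comp g h by blast
    show "real (dis (\<lambda>x. g (h x))) \<le> 2 * (\<eta> * ?n)"
    proof (cases "g \<in> H")
      case True
      have "dis (\<lambda>x. g (h x)) \<le> dis h + card {x. (h x \<in> P) \<noteq> (g (h x) \<in> P)}"
        unfolding dis_def by (rule tri) blast
      also have "card {x. (h x \<in> P) \<noteq> (g (h x) \<in> P)} = dis g"
        unfolding dis_def using pre[OF h, of "\<lambda>y. (y \<in> P) \<noteq> (g y \<in> P)"] .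
      finally have "real (dis (\<lambda>x. g (h x))) \<le> real (dis h) + real (dis g)" by linarith
      then show ?thesis using True gh by (auto simp: H_def)
    next
      case False
      have "dis (\<lambda>x. g (h x)) \<le> agr h + card {x. (h x \<in> P) = (g (h x) \<in> P)}"
        unfolding dis_def agr_def by (rule tri) blast
      also have "card {x. (h x \<in> P) = (g (h x) \<in> P)} = agr g"
        unfolding agr_def using pre[OF h, of "\<lambda>y. (y \<in> P) = (g y \<in> P)"] .
      finally have "real (dis (\<lambda>x. g (h x))) \<le> real (agr h) + real (agr g)" by linarith
      then show ?thesis using notH[OF g] notH[OF h] False gh by auto
    qed
  qed
  have invinv: "inv_into UNIV g (g x) = x" "g (inv_into UNIV g x) = x" if "g \<in> G" for g x
    using bij[OF that] by (auto simp: bij_is_inj bij_is_surj surj_f_inv_f)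
  have dinv: "dis (inv_into UNIV g) = dis g" if "g \<in> G" for g
    unfolding dis_def using pre[OF that, of "\<lambda>y. (y \<in> P) \<noteq> (inv_into UNIV g y \<in> P)"] invinv(1)[OF that]
    by (simp add: eq_commute)
  have Hinv: "(inv_into UNIV g \<in> H) = (g \<in> H)" if "g \<in> G" for g
    using dinv[OF that] inv[OF that] that by (simp add: H_def)
  have diff: "(\<lambda>x. g (h x)) \<notin> H" if g: "g \<in> G" "g \<notin> H" and h: "h \<in> H" for g h
  proof
    assume "(\<lambda>x. g (h x)) \<in> H"
    moreover have "inv_into UNIV h \<in> H" using Hinv[OF HG[OF h]] h by simp
    ultimately have "(\<lambda>x. (\<lambda>x. g (h x)) (inv_into UNIV h x)) \<in> H" by (intro same) (auto simp: HG)
    then show False using g by (simp add: invinv[OF HG[OF h]])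
  qed
  \<comment> \<open>Normality of \<open>H\<close>, needed to carry one edge inside an orbit to every
    vertex.\<close>
  have conj: "(\<lambda>x. g (k (inv_into UNIV g x))) \<in> H" if g: "g \<in> G" and k: "k \<in> H" for g k
  proof -
    have "(\<lambda>x. g (k x)) \<in> G" using comp g HG[OF k] by blast
    moreover have "((\<lambda>x. g (k x)) \<in> H) = (inv_into UNIV g \<in> H)"
      using diff[OF g _ k] same[OF g HG[OF k]] k Hinv[OF g] by blast
    ultimately show ?thesis using same[of "\<lambda>x. g (k x)" "inv_into UNIV g"] inv[OF g] by simp
  qed
  define R where "R x y \<longleftrightarrow> (\<exists>h\<in>H. h x = y)" for x y
  obtain u v where uv: "c u v > 0" "R u v"
  proof -
    fix x0 :: 'v
    \<comment> \<open>The candidate bipartition is the \<open>H\<close>-orbit of \<open>x0\<close>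
      against its complement; it fails on some edge.\<close>
    obtain u v where uv: "c u v > 0" "R x0 u = R x0 v"
      using nonbip[of "{x. R x0 x}"] by auto
    obtain a b where a: "a \<in> G" "a x0 = u" and b: "b \<in> G" "b x0 = v" using trans by meson
    have "R u v"
    proof (cases "R x0 u")
      case True
      then obtain h k where "h \<in> H" "h x0 = u" "k \<in> H" "k x0 = v" using uv by (auto simp: R_def)
      then have "(\<lambda>x. k (inv_into UNIV h x)) \<in> H" "k (inv_into UNIV h u) = v"
        using same[of k "inv_into UNIV h"] Hinv[of h] inv[of h] invinv(1)[of h x0] HG by auto
      then show ?thesis unfolding R_def by (intro bexI[of _ "\<lambda>x. k (inv_into UNIV h x)"])
    next
      case False
      \<comment> \<open>Outside the orbit of \<open>x0\<close>, both vertices are reached from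
        \<open>x0\<close> by elements of the other coset, whose quotient lies in
        \<open>H\<close>.\<close>
      then have "a \<notin> H" "b \<notin> H" using a b uv by (auto simp: R_def)
      then have "(\<lambda>x. b (inv_into UNIV a x)) \<in> H" "b (inv_into UNIV a u) = v"
        using same[of b "inv_into UNIV a"] Hinv[of a] inv[of a] invinv(1)[of a x0] a b by auto
      then show ?thesis unfolding R_def by (intro bexI[of _ "\<lambda>x. b (inv_into UNIV a x)"])
    qed
    then show thesis using uv that by blast
  qed
  have nb: "\<exists>y. c x y > 0 \<and> R x y" for x
  proof -
    obtain g where g: "g \<in> G" "g u = x" using trans by meson
    obtain k where k: "k \<in> H" "k u = v" using uv by (auto simp: R_def)
    have "inv_into UNIV g x = u" using g invinv(1)[of g u] by simp
    then have "R x (g v)" unfolding R_def using conj[OF g(1) k(1)] k(2)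
      by (intro bexI[of _ "\<lambda>x. g (k (inv_into UNIV g x))"]) auto
    moreover have "c x (g v) > 0" using aut[OF g(1), of u v] g uv by simp
    ultimately show ?thesis by blast
  qed
  define s :: "'v \<Rightarrow> real" where "s x = (if x \<in> P then 1 else -1)" for x
  define K where "K = real (card H)"
  have K: "K > 0" using Hid by (auto simp: K_def card_gt_0_iff)
  \<comment> \<open>Summing the sign over \<open>H\<close> gives a function exactly constant on
    orbits, and \<open>e\<close> measures how far \<open>s\<close> is from its orbit average, scaled
    by \<open>K\<close>.\<close>
  define \<Phi> where "\<Phi> x = (\<Sum>h\<in>H. s (h x))" for x
  define e where "e x = \<bar>\<Phi> x - K * s x\<bar>" for x
  have \<Phi>R: "\<Phi> x = \<Phi> y" if xy: "R x y" for x y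
  proof -
    obtain k where k: "k \<in> H" "k x = y" using xy by (auto simp: R_def)
    have "bij_betw (\<lambda>h x. h (k x)) H H"
    proof (rule bij_betw_byWitness[where f' = "\<lambda>h x. h (inv_into UNIV k x)"])
      show "(\<lambda>h x. h (k x)) ` H \<subseteq> H" using same k HG by auto
      show "(\<lambda>h x. h (inv_into UNIV k x)) ` H \<subseteq> H"
        using same[of _ "inv_into UNIV k"] Hinv[of k] inv[of k] k HG by auto
    qed (auto simp: invinv[OF HG[OF k(1)]])
    from sum.reindex_bij_betw[OF this, of "\<lambda>h. s (h x)"] show ?thesis
      by (simp add: \<Phi>_def k)
  qed
  have esum: "(\<Sum>x\<in>UNIV. e x) \<le> 2 * K * (\<eta> * ?n)"
  proof -
    have "(\<Sum>x\<in>UNIV. e x) = (\<Sum>x\<in>UNIV. \<bar>\<Sum>h\<in>H. s (h x) - s x\<bar>)"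
      by (simp add: e_def \<Phi>_def K_def sum_subtractf)
    also have "\<dots> \<le> (\<Sum>x\<in>UNIV. \<Sum>h\<in>H. \<bar>s (h x) - s x\<bar>)" by (intro sum_mono sum_abs)
    also have "\<dots> = (\<Sum>h\<in>H. \<Sum>x\<in>UNIV. \<bar>s (h x) - s x\<bar>)" by (rule sum.swap)
    also have "\<dots> \<le> (\<Sum>h\<in>H. 2 * (\<eta> * ?n))"
    proof (rule sum_mono)
      fix h assume h: "h \<in> H"
      have "\<bar>s (h x) - s x\<bar> = 2 * of_bool ((x \<in> P) \<noteq> (h x \<in> P))" for x by (auto simp: s_def)
      then have "(\<Sum>x\<in>UNIV. \<bar>s (h x) - s x\<bar>) = 2 * real (dis h)"
        by (simp add: dis_def flip: sum_distrib_left)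
      then show "(\<Sum>x\<in>UNIV. \<bar>s (h x) - s x\<bar>) \<le> 2 * (\<eta> * ?n)" using h by (simp add: H_def)
    qed
    finally show ?thesis by (simp add: K_def)
  qed
  \<comment> \<open>Every vertex has an edge inside its orbit, so these number at least
    \<open>?n\<close> as ordered pairs.\<close>
  have "?n = (\<Sum>x\<in>(UNIV::'v set). 1)" by simp
  also have "\<dots> \<le> (\<Sum>x\<in>UNIV. \<Sum>y\<in>UNIV. real (c x y) * of_bool (R x y))"
  proof (rule sum_mono)
    fix x
    obtain y where y: "c x y > 0" "R x y" using nb by blast
    then have "1 \<le> real (c x y) * of_bool (R x y)" by simp
    also have "\<dots> \<le> (\<Sum>y\<in>UNIV. real (c x y) * of_bool (R x y))"
      by (rule member_le_sum) auto
    finally show "1 \<le> (\<Sum>y\<in>UNIV. real (c x y) * of_bool (R x y))" .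
  qed
  finally have lower: "?n \<le> (\<Sum>x\<in>UNIV. \<Sum>y\<in>UNIV. real (c x y) * of_bool (R x y))" .
  have "2 * K * ?n \<le> 2 * K * (\<Sum>x\<in>UNIV. \<Sum>y\<in>UNIV. real (c x y) * of_bool (R x y))"
    using lower K by (intro mult_left_mono) auto
  also have "\<dots> = (\<Sum>x\<in>UNIV. \<Sum>y\<in>UNIV. real (c x y) * (2 * K * of_bool (R x y)))"
    unfolding sum_distrib_left by (simp only: mult.left_commute)
  also have "\<dots> \<le> (\<Sum>x\<in>UNIV. \<Sum>y\<in>UNIV. real (c x y) *
      (2 * K * of_bool ((x \<in> P) = (y \<in> P)) + e x + e y))"
  proof (intro sum_mono mult_left_mono)
    fix x y
    have e0: "e x \<ge> 0" "e y \<ge> 0" by (simp_all add: e_def)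
    show "2 * K * of_bool (R x y) \<le> 2 * K * of_bool ((x \<in> P) = (y \<in> P)) + e x + e y"
    proof (cases "R x y \<and> (x \<in> P) \<noteq> (y \<in> P)")
      case True
      then have "\<Phi> x = \<Phi> y" using \<Phi>R by blast
      \<comment> \<open>The common value of \<open>\<Phi>\<close> has total distance at least
        \<open>2 * K\<close> from \<open>K\<close> and \<open>-K\<close>.\<close>
      then have "2 * K \<le> e x + e y" using True K by (auto simp: e_def s_def)
      then show ?thesis using True by simp
    next
      case False
      then show ?thesis using e0 K by auto
    qed
  qed simp
  also have "\<dots> = 2 * K * B + 2 * real d * (\<Sum>x\<in>UNIV. e x)"
  proof -
    have "(\<Sum>x\<in>UNIV. \<Sum>y\<in>UNIV. real (c x y) *
        (2 * K * of_bool ((x \<in> P) = (y \<in> P)) + e x + e y))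
      = 2 * K * B + (\<Sum>x\<in>UNIV. \<Sum>y\<in>UNIV. real (c x y) * e x)
        + (\<Sum>x\<in>UNIV. \<Sum>y\<in>UNIV. real (c x y) * e y)"
      unfolding distrib_left sum.distrib B_def sum_distrib_left by (simp only: mult.left_commute)
    then show ?thesis unfolding sum_fst[of e] sum_snd[of e] by simp
  qed
  also have "\<dots> \<le> 2 * K * (?n / 16) + 2 * real d * (2 * K * (\<eta> * ?n))"
    using B1 K esum by (intro add_mono mult_left_mono) auto
  also have "\<dots> = 2 * K * (3 / 16 * ?n)"
    using d by (simp add: \<eta>_def field_simps)
  finally have "?n \<le> 3 / 16 * ?n" using K by simp
  then show False using n0 by simp
qed

end

section \<open>Automorphisms and the eigenvalue bound\<close>

lemma map_uprod_inj:
  assumes "inj g"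
  shows "inj (map_uprod g)"
proof (rule injI)
  fix e e' assume "map_uprod g e = map_uprod g e'"
  then show "e = e'" using assms
    by (cases e; cases e') (auto simp: inj_eq)
qed

text \<open>By injectivity the fibre of \<open>map_uprod g\<close> over the image of an edge is a
  single edge, so invariance of the multiset becomes invariance of each multiplicity.\<close>

lemma count_automorphism:
  assumes "inj g" "image_mset (map_uprod g) E = E"
  shows "count E (Upair (g x) (g y)) = count E (Upair x y)"
proof -
  have "map_uprod g -` {map_uprod g (Upair x y)} = {Upair x y}"
    using map_uprod_inj[OF assms(1)] by (auto dest: injD simp del: map_uprod_simps)
  then have "count (image_mset (map_uprod g) E) (map_uprod g (Upair x y)) = count E (Upair x y)"
    by (cases "Upair x y \<in># E") (simp_all only: count_image_mset, auto simp: count_eq_zero_iff)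
  then show ?thesis using assms(2) by simp
qed

theorem theorem2p3:
  fixes E :: "'v::finite multigraph"
    and d :: nat
    and \<theta> :: "nat \<Rightarrow> 'v \<Rightarrow> 'v"
    and \<G> :: "('v \<Rightarrow> 'v) set"
    and \<epsilon> :: real
  assumes "regular_of_degree E d"
    and "\<And>i. i \<in> {1..d} \<Longrightarrow> bij (\<theta> i)"
    and "\<And>v i. i \<in> {1..d} \<Longrightarrow> adjacent E v (\<theta> i v)"
    and "\<And>v. nbhd E {v} = (\<Union>i\<in>{1..d}. {\<theta> i v})"
    and "subgroup \<G> (automorphism_group E)"
    and "\<And>H. index_two_subgroup ((automorphism_group E)\<lparr>carrier := \<G>\<rparr>) H \<Longrightarrow>
           \<not> acts_transitively E H"
    and "acts_transitively E \<G>"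
    and "CARD('v) \<ge> 4"
    and "\<not> bipartite_graph E"
    and "\<epsilon> > 0"
    and "vertex_expander E \<epsilon>"
  shows "\<forall>\<mu>. nontrivial_eigenvalue E d \<mu> \<longrightarrow> \<mu> > -1 + \<epsilon> ^ 4 / (2 ^ 9 * real d ^ 10)"
proof (intro allI impI)
  fix \<mu> assume "nontrivial_eigenvalue E d \<mu>"
  then obtain f where f: "f \<noteq> 0" "normalised_adjacency E d *v f = \<mu> *s f"
    by (auto simp: nontrivial_eigenvalue_def matrix_eigenvalue_def)
  define c where "c x y = count E (Upair x y)" for x y
  have row: "(\<Sum>y\<in>UNIV. c x y) = d" for x
  proof -
    have "(adjacency_matrix E *v vec 1) $ x = (real d *s vec 1) $ x"
      using assms(1) by (simp add: regular_of_degree_def)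
    then have "real (\<Sum>y\<in>UNIV. c x y) = real d"
      by (simp add: adjacency_matrix_def matrix_vector_mult_def c_def)
    then show ?thesis by (simp only: of_nat_eq_iff)
  qed
  interpret edge_expander c d \<epsilon>
  proof
    show "c x y = c y x" for x y
    proof -
      have "Upair x y = Upair y x" by simp
      then show ?thesis by (simp only: c_def)
    qed
    show "(\<Sum>y\<in>UNIV. c x y) = d" for x by (rule row)
    show "\<epsilon> > 0" by fact
    fix A :: "'v set" assume A: "2 * card A \<le> CARD('v)"
    then have "real (card A) \<le> real CARD('v) / 2" by linarith
    then have "\<epsilon> * real (card A) \<le> real (card (nbhd E A - A))"
      using assms(11) by (simp add: vertex_expander_def)
    also have "\<dots> = (\<Sum>y\<in>nbhd E A - A. 1)" by simp
    \<comment> \<open>Vertex expansion becomes edge expansion: each outer neighbour contributes at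
      least one boundary edge.\<close>
    also have "\<dots> \<le> (\<Sum>y\<in>nbhd E A - A. \<Sum>x\<in>A. real (c x y))"
    proof (rule sum_mono)
      fix y assume "y \<in> nbhd E A - A"
      then obtain x where "x \<in> A" "c x y > 0" by (auto simp: nbhd_def adjacent_def c_def)
      then have "1 \<le> real (c x y)" by simp
      also have "\<dots> \<le> (\<Sum>x\<in>A. real (c x y))" using \<open>x \<in> A\<close> by (intro member_le_sum) auto
      finally show "1 \<le> (\<Sum>x\<in>A. real (c x y))" .
    qed
    also have "\<dots> \<le> (\<Sum>y\<in>-A. \<Sum>x\<in>A. real (c x y))"
      by (intro sum_mono2 sum_nonneg) auto
    also have "\<dots> = (\<Sum>x\<in>A. \<Sum>y\<in>-A. real (c x y))" by (rule sum.swap)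
    finally show "\<epsilon> * real (card A) \<le> (\<Sum>x\<in>A. \<Sum>y\<in>-A. real (c x y))" .
  qed
  have n: "CARD('v) \<ge> 2" using assms(8) by simp
  have d: "real d \<ge> 1" using expansion_le_degree[OF n] pos by (cases d) auto
  have carr: "\<G> \<subseteq> {\<sigma> \<in> Bij UNIV. image_mset (map_uprod \<sigma>) E = E}"
    using subgroup.subset[OF assms(5)] by (simp add: automorphism_group_def)
  have bijG: "bij g" if "g \<in> \<G>" for g using that carr by (auto simp: Bij_def)
  have many: "(\<Sum>x\<in>UNIV. \<Sum>y\<in>UNIV. real (c x y) * of_bool ((x \<in> P) = (y \<in> P)))
      > real CARD('v) * (\<epsilon>\<^sup>2 / (16 * (real d)\<^sup>2))" for P
  proof (rule many_unchanged_edges[where G = \<G>, OF n])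
    show "(\<lambda>x. x) \<in> \<G>"
      using subgroup.one_closed[OF assms(5)]
      by (simp add: automorphism_group_def BijGroup_def restrict_def)
    show "(\<lambda>x. g (h x)) \<in> \<G>" if "g \<in> \<G>" "h \<in> \<G>" for g h
      using subgroup.m_closed[OF assms(5) that] that carr
      by (auto simp: automorphism_group_def BijGroup_def restrict_def compose_def subset_eq)
    show "inv_into UNIV g \<in> \<G>" if g: "g \<in> \<G>" for g
    proof -
      have gc: "g \<in> {\<sigma> \<in> Bij UNIV. image_mset (map_uprod \<sigma>) E = E}" using g carr by blast
      have "inv\<^bsub>automorphism_group E\<^esub> g = inv\<^bsub>BijGroup UNIV\<^esub> g"
        unfolding automorphism_group_def
        by (rule group.m_inv_consistent[OF group_BijGroup subgroup_automorphism_group gc])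
      also have "\<dots> = inv_into UNIV g" using gc by (simp add: inv_BijGroup restrict_def)
      finally show ?thesis using subgroup.m_inv_closed[OF assms(5) g] by simp
    qed
    show "bij g" if "g \<in> \<G>" for g by (rule bijG[OF that])
    show "c (g x) (g y) = c x y" if "g \<in> \<G>" for g x y
      unfolding c_def using that carr bijG[OF that] by (intro count_automorphism) (auto simp: bij_is_inj)
    show "\<exists>g\<in>\<G>. g x = y" for x y using assms(7) acts_transitively_iff[OF assms(5)] by blast
    show "\<exists>u v. c u v > 0 \<and> (u \<in> X) = (v \<in> X)" for X
      using assms(9) unfolding bipartite_graph_def adjacent_def c_def by (auto simp: count_greater_zero_iff)
  qed
  have eig: "(\<Sum>y\<in>UNIV. real (c x y) * f $ y) = real d * \<mu> * f $ x" for x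
  proof -
    have "(normalised_adjacency E d *v f) $ x = \<mu> * f $ x" using f by simp
    then have "(\<Sum>y\<in>UNIV. real (c x y) * f $ y) / real d = \<mu> * f $ x"
      by (simp add: normalised_adjacency_def adjacency_matrix_def matrix_vector_mult_def c_def
          sum_divide_distrib)
    then show ?thesis using d by (simp add: field_simps)
  qed
  show "\<mu> > -1 + \<epsilon> ^ 4 / (2 ^ 9 * real d ^ 10)"
  proof (rule ccontr)
    assume "\<not> ?thesis"
    \<comment> \<open>The argument works with the exponent 5 of \<open>d\<close>; as
      \<open>d\<close> is at least 1, this covers the exponent 10.\<close>
    moreover have "\<epsilon> ^ 4 / (2 ^ 9 * real d ^ 10) \<le> \<epsilon> ^ 4 / (2 ^ 9 * real d ^ 5)"
      using d power_increasing[of 5 10 "real d"] by (intro divide_left_mono) auto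
    ultimately have "1 + \<mu> \<le> \<epsilon> ^ 4 / (2 ^ 9 * real d ^ 5)" by linarith
    moreover have "\<exists>x. f $ x \<noteq> 0" using f(1) by (auto simp: vec_eq_iff)
    ultimately obtain P where "(\<Sum>x\<in>UNIV. \<Sum>y\<in>UNIV. real (c x y) * of_bool ((x \<in> P) = (y \<in> P)))
      \<le> real CARD('v) * (\<epsilon>\<^sup>2 / (16 * (real d)\<^sup>2))"
      using nearly_bipartite[of "\<lambda>x. f $ x" \<mu>, OF eig _ n] by blast
    then show False using many[of P] by simp
  qed
qed

end
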